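(* Let $\boldsymbol{p} = (p_i)_{i\ge 1}$ be any sequence of numbers $p_i \in [0,1)$ with $0 < \lambda := \sum_{i\ge 1} p_i \le 1$. Let $p_* := \max_{i \ge 1} p_i$ and $\Delta := \lambda^{-1}\sum_{i\ge 1} p_i^2$. Let $Q$ be the distribution of $X = \sum_{i\ge 1} Z_i$, where $Z_1, Z_2, \ldots$ are independent Bernoulli random variables with $\mathbb{P}(Z_i = 1) = p_i$, and let $\mathrm{Poiss}_\lambda$ be the Poisson distribution with parameter $\lambda$. Then $$\Delta \Bigl( 1 - \frac{\Delta}{2} - \frac{\lambda}{2(1 - p_* )} \Bigr) \ \le \ \log \rho(Q, \mathrm{Poiss}_\lambda) \ \le \ \Delta .$$
   Context: Since $\sum_i p_i < \infty$, the sum $X$ is almost surely finite. For integers $x \ge 0$ let $b(x) := \mathbb{P}(X = x)$, explicitly $$b(x) = \sum_{J \subset \mathbb{N},\, \#J = x} \ \prod_{i\in J} p_i \prod_{k \in \mathbb{N}\setminus J} (1 - p_k), \qquad \mathbb{N} = \{1,2,3,\ldots\},$$ and let $\pi(x) := e^{-\lambda}\lambda^x/x!$. The maximal density ratio is $$\rho(Q,\mathrm{Poiss}_\lambda) := \sup_{x \ge 0} \frac{b(x)}{\pi(x)},$$ where the supremum is over all integers $x \ge 0$. The maximum $p_*$ is attained because $p_i \to 0$. Here $\log$ is the natural logarithm. *)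

theory Defs
  imports "HOL-Probability.Probability"
begin

text \<open>
  The values \<open>\<infinity>\<close> and the conventions \<open>0 / 0 = 0\<close> and \<open>a / 0 = \<infinity>\<close> for \<open>a > 0\<close>
  are those of \<^typ>\<open>ennreal\<close>; no quotient by zero arises when \<open>P\<close> is a Poisson distribution
  with positive parameter.
\<close>

definition max_density_ratio :: "nat measure \<Rightarrow> nat measure \<Rightarrow> ennreal" where
  "max_density_ratio Q P = (SUP x. emeasure Q {x} / emeasure P {x})"

text \<open>
  The infinite sum is taken in \<^typ>\<open>nat\<close> with its discrete topology, so it converges iff only
  finitely many terms are nonzero. Otherwise its value is an unspecified number; for Bernoulli
  variables with summable parameters this only happens on a null set
  (\<open>AE_summable_bernoulli\<close> below).
\<close>

definition sum_distribution :: "'a measure \<Rightarrow> (nat \<Rightarrow> 'a \<Rightarrow> nat) \<Rightarrow> nat measure" where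
  "sum_distribution M Z = distr M (count_space UNIV) (\<lambda>\<omega>. \<Sum>i. Z i \<omega>)"

lemma sums_nat_iff:
  fixes f :: "nat \<Rightarrow> nat"
  shows "f sums s \<longleftrightarrow> (\<exists>N. \<forall>n\<ge>N. (\<Sum>i<n. f i) = s)"
  unfolding sums_def by (simp add: tendsto_discrete eventually_sequentially)

lemma measurable_suminf_nat:
  fixes Z :: "nat \<Rightarrow> 'a \<Rightarrow> nat"
  assumes [measurable]: "\<And>i. Z i \<in> measurable M (count_space UNIV)"
  shows "(\<lambda>\<omega>. \<Sum>i. Z i \<omega>) \<in> measurable M (count_space UNIV)"
proof -
  define c where "c = (THE s :: nat. False)"
  have *: "(\<Sum>i. Z i \<omega>) = x \<longleftrightarrow>
      (\<exists>N. \<forall>n\<in>{N..}. (\<Sum>i<n. Z i \<omega>) = x) \<or>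
      (x = c \<and> \<not> (\<exists>y N. \<forall>n\<in>{N..}. (\<Sum>i<n. Z i \<omega>) = y))" for x \<omega>
  proof (cases "summable (\<lambda>i. Z i \<omega>)")
    case True
    then obtain s where s: "(\<lambda>i. Z i \<omega>) sums s"
      by (auto simp: summable_def)
    then have "(\<Sum>i. Z i \<omega>) = x \<longleftrightarrow> (\<lambda>i. Z i \<omega>) sums x"
      using sums_unique by (metis sums_unique2)
    moreover have "\<exists>y N. \<forall>n\<in>{N..}. (\<Sum>i<n. Z i \<omega>) = y"
      using s unfolding sums_nat_iff by (metis atLeast_iff)
    ultimately show ?thesis by (simp add: sums_nat_iff Ball_def)
  next
    case False
    then have no: "\<not> (\<lambda>i. Z i \<omega>) sums s" for s by (auto simp: summable_def)
    then have "(\<Sum>i. Z i \<omega>) = c" by (simp add: suminf_def c_def)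
    then show ?thesis using no by (auto simp: sums_nat_iff Ball_def)
  qed
  have [measurable]: "(\<lambda>\<omega>. \<Sum>i<n. Z i \<omega>) \<in> measurable M (count_space UNIV)" for n
    by (induction n) simp_all
  have "{\<omega> \<in> space M. (\<Sum>i. Z i \<omega>) = x} \<in> sets M" for x
    unfolding * by measurable
  then show ?thesis
    by (subst measurable_count_space_eq2_countable)
       (auto simp: vimage_def Int_def conj_commute)
qed

lemma AE_summable_bernoulli:
  fixes Z :: "nat \<Rightarrow> 'a \<Rightarrow> nat" and p :: "nat \<Rightarrow> real"
  assumes "\<And>i. Z i \<in> measurable M (count_space UNIV)"
    and "\<And>i. distr M (count_space UNIV) (Z i) = measure_pmf (map_pmf of_bool (bernoulli_pmf (p i)))"
    and "\<And>i. 0 \<le> p i \<and> p i \<le> 1" and "summable p"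
  shows "AE \<omega> in M. summable (\<lambda>i. Z i \<omega>)"
proof -
  note [measurable] = assms(1)
  have eq: "emeasure M {\<omega> \<in> space M. Z i \<omega> \<noteq> 0} = ennreal (p i)" for i
  proof -
    have "emeasure M {\<omega> \<in> space M. Z i \<omega> \<noteq> 0} = emeasure (distr M (count_space UNIV) (Z i)) (- {0})"
      by (subst emeasure_distr) (auto intro!: arg_cong[where f = "emeasure M"])
    also have "\<dots> = emeasure (measure_pmf (bernoulli_pmf (p i))) {True}"
      unfolding assms(2) by (auto simp: vimage_def intro!: arg_cong[where f = "emeasure _"])
    finally show ?thesis using assms(3)[of i] by (simp add: emeasure_pmf_single)
  qed
  have "AE \<omega> in M. eventually (\<lambda>n. \<omega> \<in> space M - {\<omega> \<in> space M. Z n \<omega> \<noteq> 0}) sequentially"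
  proof (rule borel_cantelli_AE1)
    show "summable (\<lambda>i. measure M {\<omega> \<in> space M. Z i \<omega> \<noteq> 0})"
      using assms(3,4) unfolding measure_def eq by simp
  qed (auto simp del: neq0_conv simp: eq)
  then show ?thesis
  proof eventually_elim
    case (elim \<omega>)
    then obtain N where "\<And>n. n \<ge> N \<Longrightarrow> Z n \<omega> = 0"
      by (auto simp: eventually_sequentially)
    then show ?case by (intro summable_finite[of "{..<N}"]) auto
  qed
qed

lemma Greatest_range_summable:
  fixes p :: "nat \<Rightarrow> real"
  assumes "\<And>i. 0 \<le> p i" and "summable p"
  shows "(GREATEST y. y \<in> range p) \<in> range p" and "p i \<le> (GREATEST y. y \<in> range p)"
proof -
  have "\<exists>j. \<forall>i. p i \<le> p j"
  proof (cases "\<exists>k. p k > 0")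
    case True
    then obtain k where k: "p k > 0" by blast
    have "eventually (\<lambda>n. p n < p k) sequentially"
      using summable_LIMSEQ_zero[OF assms(2)] k by (rule order_tendstoD)
    then obtain N where N: "\<And>n. n \<ge> N \<Longrightarrow> p n < p k" by (auto simp: eventually_sequentially)
    have "p i \<le> Max (p ` {..max N k})" if "i \<le> max N k" for i using that by auto
    moreover obtain j where j: "Max (p ` {..max N k}) = p j"
      using Max_in[of "p ` {..max N k}"] by blast
    ultimately have le: "p i \<le> p j" if "i \<le> max N k" for i using that by auto
    have "p i \<le> p j" for i
      using le[of i] le[of k] N[of i] by (cases "i \<le> max N k") (auto simp: not_le)
    then show ?thesis by blast
  next
    case False
    then show ?thesis using assms(1) by (metis leI order_trans)
  qed
  then obtain j where j: "\<And>i. p i \<le> p j" by blast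
  then have "(GREATEST y. y \<in> range p) = p j" by (intro Greatest_equality) auto
  then show "(GREATEST y. y \<in> range p) \<in> range p" "p i \<le> (GREATEST y. y \<in> range p)"
    using j by auto
qed

end

theory Submission
  imports Defs
begin

text \<open>
  Write \<open>b x\<close> for the probability that the sum of the Bernoulli variables equals \<open>x\<close>, and
  \<open>q\<^sub>i = p\<^sub>i / (1 - p\<^sub>i)\<close> for the odds, so that \<open>b x\<close> is \<open>b 0\<close> times the \<open>x\<close>-th elementary
  symmetric function of the odds. The whole argument rests on one fact: when \<open>\<lambda> \<le> 1\<close>, the
  density ratio \<open>b x / \<pi> x\<close> is largest at \<open>x = 1\<close>. After that only the number
  \<open>b 1 = (\<Prod>i. 1 - p\<^sub>i) * (\<Sum>i. q\<^sub>i)\<close> has to be estimated.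

  \<^bold>\<open>Location of the maximum.\<close> A sum of independent Bernoulli variables is ultra log-concave
  (\<open>poibin_ultra_log_concave\<close>): the density ratio is log-concave in \<open>x\<close>. Hence it decreases from
  \<open>1\<close> onwards as soon as it does not increase from \<open>1\<close> to \<open>2\<close>. This last claim,
  \<open>2 * b 2 \<le> \<lambda> * b 1\<close>, is an inequality between power sums that follows from the nonnegativity of
  a variance and uses \<open>\<lambda> \<le> 1\<close> (\<open>poibin_2_le\<close>). The step from \<open>0\<close> to \<open>1\<close> says that the odds
  add up to at least \<open>\<lambda>\<close>.

  \<^bold>\<open>Upper bound.\<close> With the generating function \<open>f t = (\<Prod>i. 1 - p\<^sub>i + p\<^sub>i * t)\<close> one has
  \<open>b 1 = f' 0\<close> and \<open>\<lambda> = f' 1\<close>, and \<open>(ln f')' 1 = \<lambda> - \<Delta>\<close>. The function \<open>ln f'\<close> is concave on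
  \<open>[0, 1]\<close>, so that \<open>ln (b 1) \<le> ln \<lambda> - (\<lambda> - \<Delta>)\<close>, which is the claim (\<open>poibin_1_le\<close>).

  \<^bold>\<open>Lower bound.\<close> Expanding the odds gives \<open>(\<Sum>i. q\<^sub>i) \<ge> \<lambda> * (1 + \<Delta>)\<close>, and the logarithmic
  series gives \<open>ln (1 - p\<^sub>i) \<ge> - p\<^sub>i - p\<^sub>i\<^sup>2 / (2 * (1 - p\<^sub>i))\<close> (\<open>poibin_1_ge\<close>); the remaining loss
  is \<open>ln (1 + \<Delta>) \<ge> \<Delta> - \<Delta>\<^sup>2 / 2\<close>.

  All inequalities are proved for finitely many summands, where the mass function obeys a
  recursion, and pass to the limit because almost every sample has only finitely many successes
  (\<open>poibin_tendsto_prob_suminf\<close>).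
\<close>

section \<open>The mass function of a finite sum of Bernoulli variables\<close>

text \<open>
  The Poisson binomial distribution of the first \<open>n\<close> summands, given by conditioning on the last
  one; this form makes its explicit values and its ultra log-concavity accessible to induction on
  the number of summands.
\<close>

primrec poibin :: "(nat \<Rightarrow> real) \<Rightarrow> nat \<Rightarrow> nat \<Rightarrow> real" where
  "poibin p 0 x = of_bool (x = 0)"
| "poibin p (Suc n) x =
     (1 - p n) * poibin p n x + p n * (case x of 0 \<Rightarrow> 0 | Suc y \<Rightarrow> poibin p n y)"

lemma poibin_nonneg:
  assumes "\<And>i. 0 \<le> p i \<and> p i \<le> 1"
  shows "0 \<le> poibin p n x"
  using assms by (induction n arbitrary: x) (auto split: nat.split)

lemma poibin_0: "poibin p n 0 = (\<Prod>i<n. 1 - p i)"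
  by (induction n) (auto simp: mult.commute)

text \<open>
  The next two lemmas give the first two elementary symmetric functions of the odds, the second one
  through power sums.
\<close>

lemma poibin_1:
  assumes "\<And>i. 0 \<le> p i \<and> p i < (1::real)"
  shows "poibin p n 1 = (\<Prod>i<n. 1 - p i) * (\<Sum>i<n. p i / (1 - p i))"
proof (induction n)
  case (Suc n)
  have "1 - p n \<noteq> 0" using assms[of n] by simp
  then show ?case using Suc by (simp add: poibin_0 field_simps)
qed simp

lemma poibin_2:
  assumes "\<And>i. 0 \<le> p i \<and> p i < (1::real)"
  shows "2 * poibin p n 2 =
    (\<Prod>i<n. 1 - p i) * ((\<Sum>i<n. p i / (1 - p i))\<^sup>2 - (\<Sum>i<n. (p i / (1 - p i))\<^sup>2))"
proof (induction n)
  case (Suc n)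
  define P q Q R where "P = (\<Prod>i<n. 1 - p i)" and "q = p n / (1 - p n)"
    and "Q = (\<Sum>i<n. p i / (1 - p i))" and "R = (\<Sum>i<n. (p i / (1 - p i))\<^sup>2)"
  have pn: "p n = q * (1 - p n)" using assms[of n] by (simp add: q_def)
  have e1: "2 * poibin p n 2 = P * (Q\<^sup>2 - R)" using Suc by (simp add: P_def Q_def R_def)
  have e2: "poibin p n 1 = P * Q"
    using poibin_1[where p = p and n = n, OF assms] by (simp add: P_def Q_def)
  have "2 * poibin p (Suc n) 2 = (1 - p n) * (2 * poibin p n 2) + 2 * p n * poibin p n 1"
    by (simp add: numeral_2_eq_2)
  also have "\<dots> = (1 - p n) * (P * (Q\<^sup>2 - R)) + 2 * (q * (1 - p n)) * (P * Q)"
    unfolding e1 e2 by (simp only: pn[symmetric])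
  also have "\<dots> = P * (1 - p n) * ((Q + q)\<^sup>2 - (R + q\<^sup>2))"
    by (simp add: power2_eq_square algebra_simps)
  finally show ?case by (simp add: P_def Q_def R_def q_def)
qed simp

section \<open>The density ratio is largest at one\<close>

text \<open>
  Dividing by powers of \<open>\<lambda>\<close> shows that this is log-concavity of the density ratio with respect to
  a Poisson law. The two-index form is equivalent to the one with neighbouring indices for sequences
  without internal zeros; it survives in the induction without any discussion of zeros. Adding a
  summand of parameter \<open>q\<close> turns \<open>c x = x! * b x\<close> into \<open>(1 - q) * c x + q * x * c (x - 1)\<close>; in
  the difference of the two sides, the coefficients of \<open>(1 - q)\<^sup>2\<close>, \<open>q\<^sup>2\<close> and \<open>q * (1 - q)\<close> all
  have the right sign.
\<close>

lemma poibin_ultra_log_concave: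
  assumes p: "\<And>i. 0 \<le> p i \<and> p i \<le> (1::real)" and "x \<le> y"
  shows "(fact (Suc y) * poibin p n (Suc y)) * (fact x * poibin p n x) \<le>
         (fact (Suc x) * poibin p n (Suc x)) * (fact y * poibin p n y)"
  using \<open>x \<le> y\<close>
proof (induction n arbitrary: x y)
  case (Suc n)
  define c where "c x = fact x * poibin p n x" for x
  define q where "q = p n"
  define s where "s = 1 - q"
  \<comment> \<open>The shift of \<open>c\<close>; the value at \<open>0\<close> is always multiplied by the factor \<open>x = 0\<close>.\<close>
  define d where "d x = (case x of 0 \<Rightarrow> 0 | Suc y \<Rightarrow> c y)" for x
  have qs: "0 \<le> q" "0 \<le> s" using p[of n] by (auto simp: q_def s_def)
  have c0: "0 \<le> c x" for x using poibin_nonneg[where p = p, OF p] by (simp add: c_def)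
  have d0: "0 \<le> d x" for x using c0 by (simp add: d_def split: nat.split)
  have dS: "d (Suc x) = c x" for x by (simp add: d_def)
  have rec: "fact x * poibin p (Suc n) x = s * c x + q * (real x * d x)" for x
    by (cases x) (simp_all add: c_def d_def q_def s_def algebra_simps)
  have IH: "c (Suc y) * c x \<le> c (Suc x) * c y" if "x \<le> y" for x y
    using Suc.IH[OF that] by (simp add: c_def)
  have IHd: "c y * d x \<le> c x * d y" if "x \<le> y" for x y
    using that IH c0 d0 by (cases x; cases y) (auto simp: d_def)
  have A: "c (Suc y) * c x \<le> c (Suc x) * c y" using IH Suc.prems .
  have B: "real (Suc y) * real x * (c y * d x) \<le> real (Suc x) * real y * (c x * d y)"
  proof (rule mult_mono)
    show "real (Suc y) * real x \<le> real (Suc x) * real y"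
      using Suc.prems by (simp add: algebra_simps)
  qed (use IHd[OF Suc.prems] c0 d0 in auto)
  \<comment> \<open>For \<open>x < y\<close>, one copy of \<open>c y * c x\<close> on the right is cancelled and \<open>y\<close> copies are compared:
    \<open>x * c (y+1) * c (x-1) + (y-x) * c y * c x \<le> y * c y * c x \<le> y * c (x+1) * c (y-1)\<close>.\<close>
  have C: "c (Suc y) * (real x * d x) + real (Suc y) * c y * c x
           \<le> c (Suc x) * (real y * d y) + real (Suc x) * c x * c y"
  proof (cases "x = y")
    case False
    then obtain z where y: "y = Suc z" and xz: "x \<le> z" using Suc.prems by (cases y) auto
    have 1: "c y * c x \<le> c (Suc x) * d y" using IH[OF xz] by (simp add: y d_def)
    have 2: "c (Suc y) * d x \<le> c x * c y" using IHd[of x "Suc y"] Suc.prems by (simp add: dS)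
    have "c (Suc y) * (real x * d x) + (real y - real x) * (c y * c x)
          \<le> real x * (c x * c y) + (real y - real x) * (c y * c x)"
      using mult_left_mono[OF 2, of "real x"] by (simp add: algebra_simps)
    also have "\<dots> = real y * (c y * c x)" by (simp add: algebra_simps)
    also have "\<dots> \<le> real y * (c (Suc x) * d y)" using 1 by (intro mult_left_mono) auto
    finally show ?thesis by (simp add: algebra_simps)
  qed (simp add: algebra_simps)
  have "(s * c (Suc y) + q * (real (Suc y) * c y)) * (s * c x + q * (real x * d x))
      = s * s * (c (Suc y) * c x) + q * q * (real (Suc y) * real x * (c y * d x))
        + s * q * (c (Suc y) * (real x * d x) + real (Suc y) * c y * c x)"
    by (simp add: algebra_simps)
  also have "\<dots> \<le> s * s * (c (Suc x) * c y) + q * q * (real (Suc x) * real y * (c x * d y))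
        + s * q * (c (Suc x) * (real y * d y) + real (Suc x) * c x * c y)"
    by (rule add_mono[OF add_mono])
      (intro mult_left_mono A B C; use qs in simp)+
  also have "\<dots> = (s * c (Suc x) + q * (real (Suc x) * c x)) * (s * c y + q * (real y * d y))"
    by (simp add: algebra_simps)
  finally show ?case unfolding rec dS .
qed (auto simp: not_le)

text \<open>These are the first two terms of the geometric series for the odds.\<close>

lemma sum_le_sum_odds:
  assumes p: "\<And>i. 0 \<le> p i \<and> p i < (1::real)"
  shows "(\<Sum>i<n. p i) + (\<Sum>i<n. (p i)\<^sup>2) \<le> (\<Sum>i<n. p i / (1 - p i))"
  unfolding sum.distrib[symmetric]
proof (rule sum_mono)
  fix i
  have "(p i + (p i)\<^sup>2) * (1 - p i) = p i - p i ^ 3"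
    by (simp add: power2_eq_square power3_eq_cube algebra_simps)
  also have "\<dots> \<le> p i" using p[of i] by simp
  finally show "p i + (p i)\<^sup>2 \<le> p i / (1 - p i)" using p[of i] by (simp add: pos_le_divide_eq)
qed

text \<open>
  With \<open>f\<^sub>i = 1 / (1 - p\<^sub>i)\<close>, \<open>E = (\<Sum>i. p\<^sub>i * f\<^sub>i)\<close> and \<open>T = (\<Sum>i. p\<^sub>i * f\<^sub>i\<^sup>2)\<close>, the odds have sum
  \<open>E\<close> and sum of squares \<open>T - E\<close>, so the claim reads \<open>E\<^sup>2 - (T - E) \<le> \<lambda> * E\<close>. The variance of \<open>f\<close>
  under the weights \<open>p\<^sub>i / \<lambda>\<close> is nonnegative, that is, \<open>E\<^sup>2 \<le> \<lambda> * T\<close>; replacing \<open>T\<close> by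
  \<open>E\<^sup>2 / \<lambda>\<close> leaves \<open>(1 - \<lambda>) * E * (E - \<lambda>) \<ge> 0\<close>.
\<close>

lemma poibin_2_le:
  assumes p: "\<And>i. 0 \<le> p i \<and> p i < (1::real)" and le1: "(\<Sum>i<n. p i) \<le> 1"
  shows "2 * poibin p n 2 \<le> (\<Sum>i<n. p i) * poibin p n 1"
proof -
  define f where "f i = 1 / (1 - p i)" for i
  define l E T where "l = (\<Sum>i<n. p i)" and "E = (\<Sum>i<n. p i / (1 - p i))"
    and "T = (\<Sum>i<n. p i * (f i)\<^sup>2)"
  have q: "p i / (1 - p i) = p i * f i" and f: "p i * f i = f i - 1" for i
    using p[of i] by (simp_all add: f_def field_simps)
  have "(p i / (1 - p i))\<^sup>2 = p i * (f i)\<^sup>2 - p i / (1 - p i)" for i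
    unfolding q power2_eq_square using f[of i] by (metis mult.assoc right_diff_distrib mult_1_right)
  then have sq: "(\<Sum>i<n. (p i / (1 - p i))\<^sup>2) = T - E"
    by (simp add: T_def E_def sum_subtractf)
  have l0: "0 \<le> l" using p by (simp add: l_def sum_nonneg)
  have "0 \<le> (\<Sum>i<n. (p i)\<^sup>2)" by (simp add: sum_nonneg)
  then have lE: "l \<le> E" using sum_le_sum_odds[where p = p and n = n, OF p] by (simp add: l_def E_def)
  have "0 \<le> (\<Sum>i<n. p i * (l * f i - E)\<^sup>2)" using p by (intro sum_nonneg) auto
  also have "\<dots> = (\<Sum>i<n. l\<^sup>2 * (p i * (f i)\<^sup>2) - 2 * l * E * (p i * f i) + E\<^sup>2 * p i)"
    by (intro sum.cong) (simp_all add: power2_eq_square algebra_simps)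
  also have "\<dots> = l\<^sup>2 * T - 2 * l * E * E + E\<^sup>2 * l"
    unfolding sum.distrib sum_subtractf sum_distrib_left[symmetric]
    by (simp add: T_def E_def l_def q)
  also have "\<dots> = l * (l * T - E\<^sup>2)" by (simp add: power2_eq_square algebra_simps)
  finally have var: "0 \<le> l * (l * T - E\<^sup>2)" .
  have "E\<^sup>2 - (T - E) \<le> l * E"
  proof (cases "l = 0")
    case True
    then have "p i = 0" if "i < n" for i
      using that p unfolding l_def by (subst (asm) sum_nonneg_eq_0_iff) auto
    then show ?thesis by (simp add: E_def T_def)
  next
    case False
    then have "0 < l" using l0 by simp
    then have "E\<^sup>2 \<le> l * T" using var by (simp add: zero_le_mult_iff)
    have "l * (E\<^sup>2 - (T - E) - l * E) = (E\<^sup>2 - l * T) - (1 - l) * E * (E - l)"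
      by (simp add: power2_eq_square algebra_simps)
    also have "\<dots> \<le> 0"
    proof -
      have "0 \<le> (1 - l) * E * (E - l)" using le1 lE l0 by (auto simp: l_def[symmetric])
      then show ?thesis using \<open>E\<^sup>2 \<le> l * T\<close> by linarith
    qed
    finally show ?thesis using \<open>0 < l\<close> by (simp add: mult_le_0_iff)
  qed
  moreover have "0 \<le> (\<Prod>i<n. 1 - p i)" using p by (intro prod_nonneg) (auto simp: less_imp_le)
  ultimately have "(\<Prod>i<n. 1 - p i) * (E\<^sup>2 - (T - E)) \<le> (\<Prod>i<n. 1 - p i) * (l * E)"
    by (rule mult_left_mono)
  then show ?thesis
    unfolding poibin_2[where p = p, OF p] poibin_1[where p = p, OF p] sq l_def[symmetric] E_def[symmetric]
    by (simp add: algebra_simps)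
qed

lemma poibin_0_le:
  assumes p: "\<And>i. 0 \<le> p i \<and> p i < (1::real)"
  shows "(\<Sum>i<n. p i) * poibin p n 0 \<le> poibin p n 1"
proof -
  have "0 \<le> (\<Sum>i<n. (p i)\<^sup>2)" by (simp add: sum_nonneg)
  then have "(\<Sum>i<n. p i) \<le> (\<Sum>i<n. p i / (1 - p i))" using sum_le_sum_odds[where p = p and n = n, OF p] by simp
  moreover have "0 \<le> (\<Prod>i<n. 1 - p i)" using p by (intro prod_nonneg) (auto simp: less_imp_le)
  ultimately show ?thesis
    unfolding poibin_0 poibin_1[where p = p, OF p]
    by (subst mult.commute) (rule mult_left_mono)
qed

lemma poibin_1_pos:
  assumes p: "\<And>i. 0 \<le> p i \<and> p i < (1::real)" and pos: "0 < (\<Sum>i<n. p i)"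
  shows "0 < poibin p n 1"
proof -
  have "0 < poibin p n 0" unfolding poibin_0 using p by (intro prod_pos) simp
  then show ?thesis using poibin_0_le[where p = p and n = n, OF p] pos
    by (meson less_le_trans mult_pos_pos)
qed

text \<open>
  Ultra log-concavity compares the step at \<open>x\<close> with the step at \<open>1\<close>, where \<open>poibin_2_le\<close> applies.
\<close>

lemma poibin_Suc_le:
  assumes p: "\<And>i. 0 \<le> p i \<and> p i < (1::real)" and le1: "(\<Sum>i<n. p i) \<le> 1"
    and pos: "0 < (\<Sum>i<n. p i)" and x: "1 \<le> x"
  shows "real (Suc x) * poibin p n (Suc x) \<le> (\<Sum>i<n. p i) * poibin p n x"
proof -
  have p_le: "0 \<le> p i \<and> p i \<le> 1" for i using p[of i] by simp
  have "poibin p n 1 * (fact (Suc x) * poibin p n (Suc x))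
      \<le> (2 * poibin p n 2) * (fact x * poibin p n x)"
    using poibin_ultra_log_concave[where p = p and n = n, OF p_le x] by (simp add: numeral_2_eq_2 algebra_simps)
  also have "\<dots> \<le> ((\<Sum>i<n. p i) * poibin p n 1) * (fact x * poibin p n x)"
    using poibin_2_le[where p = p, OF p le1] poibin_nonneg[where p = p, OF p_le] by (intro mult_right_mono) auto
  finally have "(poibin p n 1 * fact x) * (real (Suc x) * poibin p n (Suc x))
      \<le> (poibin p n 1 * fact x) * ((\<Sum>i<n. p i) * poibin p n x)"
    by (simp add: algebra_simps)
  then show ?thesis using poibin_1_pos[where p = p, OF p pos] by (simp del: of_nat_Suc)
qed

section \<open>Upper bound for the mass at one\<close>

text \<open>
  The quantity is \<open>2 * e\<^sub>2 / e\<^sub>1\<close> for the elementary symmetric functions \<open>e\<^sub>1\<close>, \<open>e\<^sub>2\<close>. As a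
  function of the vector it is concave and homogeneous, so its value at \<open>b\<close> is at most the value
  at \<open>b\<close> of the linear function \<open>\<Sum>i. (1 - 2 * u\<^sub>i + U) * b\<^sub>i\<close> that is tangent at \<open>a\<close>, where
  \<open>u = a / sum a\<close> and \<open>U\<close> is the sum of the squares of \<open>u\<close>. The coefficients are at least
  \<open>(1 - u\<^sub>i)\<^sup>2\<close>, hence the linear function only grows when \<open>b\<close> is replaced by \<open>a\<close>.
\<close>

lemma sum_minus_normalized_squares_mono:
  fixes a b :: "'i \<Rightarrow> real"
  assumes "finite I" and ba: "\<And>i. i \<in> I \<Longrightarrow> 0 \<le> b i \<and> b i \<le> a i" and pos: "0 < sum b I"
  shows "sum b I - (\<Sum>i\<in>I. (b i)\<^sup>2) / sum b I \<le> sum a I - (\<Sum>i\<in>I. (a i)\<^sup>2) / sum a I"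
proof -
  define s t where "s = sum a I" and "t = sum b I"
  have "t \<le> s" unfolding s_def t_def using ba by (intro sum_mono) auto
  then have st: "0 < s" "0 < t" using pos by (auto simp: t_def)
  define u where "u i = a i / s" for i
  define U where "U = (\<Sum>i\<in>I. (u i)\<^sup>2)"
  have "(\<Sum>i\<in>I. 2 * u i * b i - (u i)\<^sup>2 * t) \<le> (\<Sum>i\<in>I. (b i)\<^sup>2 / t)"
  proof (rule sum_mono)
    fix i
    have "0 \<le> (b i - u i * t)\<^sup>2 / t" using st by simp
    also have "\<dots> = (b i)\<^sup>2 / t - (2 * u i * b i - (u i)\<^sup>2 * t)"
      using st by (simp add: power2_eq_square field_simps)
    finally show "2 * u i * b i - (u i)\<^sup>2 * t \<le> (b i)\<^sup>2 / t" by simp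
  qed
  then have "t - (\<Sum>i\<in>I. (b i)\<^sup>2) / t \<le> t - (\<Sum>i\<in>I. 2 * u i * b i) + U * t"
    by (simp add: sum_subtractf U_def sum_distrib_right sum_divide_distrib)
  also have "\<dots> = (\<Sum>i\<in>I. (1 - 2 * u i + U) * b i)"
    by (simp add: t_def sum_distrib_left sum.distrib sum_subtractf algebra_simps)
  also have "\<dots> \<le> (\<Sum>i\<in>I. (1 - 2 * u i + U) * a i)"
  proof (intro sum_mono mult_left_mono)
    fix i assume i: "i \<in> I"
    show "b i \<le> a i" using ba i by simp
    have "(u i)\<^sup>2 \<le> U" unfolding U_def using i \<open>finite I\<close> by (intro member_le_sum) auto
    moreover have "0 \<le> (1 - u i)\<^sup>2" by simp
    ultimately show "0 \<le> 1 - 2 * u i + U" by (simp add: power2_eq_square algebra_simps)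
  qed
  also have "\<dots> = s - 2 * (\<Sum>i\<in>I. u i * a i) + U * s"
    by (simp add: s_def sum_distrib_left sum.distrib sum_subtractf algebra_simps)
  also have "(\<Sum>i\<in>I. u i * a i) = (\<Sum>i\<in>I. (a i)\<^sup>2) / s"
    by (simp add: u_def power2_eq_square sum_divide_distrib)
  also have "U * s = (\<Sum>i\<in>I. (a i)\<^sup>2) / s"
    using st by (simp add: U_def u_def power_divide sum_divide_distrib[symmetric] power2_eq_square)
  finally show ?thesis by (simp add: s_def t_def)
qed

text \<open>
  Below, \<open>L\<close> is the logarithm of the derivative of the generating function, and
  \<open>L' t\<close> is the quantity of the previous lemma for the vector \<open>a\<^sub>i t = p\<^sub>i / (1 - p\<^sub>i + p\<^sub>i * t)\<close>.
  This vector is componentwise smallest on \<open>[0, 1]\<close> at \<open>t = 1\<close>, where it equals \<open>p\<close>; so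
  \<open>L' \<ge> L' 1\<close> throughout and the mean value theorem bounds \<open>L 1 - L 0\<close> from below.
\<close>

lemma poibin_1_le:
  assumes p: "\<And>i. 0 \<le> p i \<and> p i < (1::real)" and pos: "0 < (\<Sum>i<n. p i)"
  shows "poibin p n 1 \<le> (\<Sum>i<n. p i) * exp ((\<Sum>i<n. (p i)\<^sup>2) / (\<Sum>i<n. p i) - (\<Sum>i<n. p i))"
proof -
  define l S where "l = (\<Sum>i<n. p i)" and "S = (\<Sum>i<n. (p i)\<^sup>2)"
  define h where "h i t = 1 - p i + p i * t" for i t
  define a where "a i t = p i / h i t" for i t
  define L where "L t = (\<Sum>i<n. ln (h i t)) + ln (\<Sum>i<n. a i t)" for t
  define L' where "L' t = (\<Sum>i<n. a i t) - (\<Sum>i<n. (a i t)\<^sup>2) / (\<Sum>i<n. a i t)" for t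
  have h_pos: "0 < h i t" and h_le: "h i t \<le> 1" if "0 \<le> t" "t \<le> 1" for i t
  proof -
    show "0 < h i t" using p[of i] that unfolding h_def
      by (meson add_pos_nonneg diff_gt_0_iff_gt mult_nonneg_nonneg)
    show "h i t \<le> 1" using p[of i] that mult_left_mono[of t 1 "p i"] by (simp add: h_def)
  qed
  have a_ge: "p i \<le> a i t" if "0 \<le> t" "t \<le> 1" for i t
    using p[of i] h_pos[OF that, of i] mult_left_mono[OF h_le[OF that, of i], of "p i"]
    by (simp add: a_def pos_le_divide_eq)
  have sum_a: "0 < (\<Sum>i<n. a i t)" if "0 \<le> t" "t \<le> 1" for t
    using pos sum_mono[of "{..<n}" p "\<lambda>i. a i t"] a_ge[OF that] by force
  have der_a: "((\<lambda>t. a i t) has_real_derivative - (a i t)\<^sup>2) (at t)"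
    if "0 \<le> t" "t \<le> 1" for i t
  proof -
    have "((\<lambda>t. p i / (1 - p i + p i * t)) has_real_derivative
        (0 * h i t - p i * p i) / (h i t * h i t)) (at t)"
      unfolding h_def
      by (rule derivative_eq_intros refl | use h_pos[OF that, of i] in \<open>simp add: h_def\<close>)+
    then show ?thesis unfolding a_def by (simp add: h_def power2_eq_square)
  qed
  have der_h: "((\<lambda>t. ln (h i t)) has_real_derivative a i t) (at t)"
    if "0 \<le> t" "t \<le> 1" for i t
    unfolding h_def a_def
    by (rule derivative_eq_intros refl | use h_pos[OF that, of i] in \<open>simp add: h_def\<close>)+
  have der: "(L has_real_derivative L' t) (at t)" if "0 \<le> t" "t \<le> 1" for t
  proof -
    have "((\<lambda>t. \<Sum>i<n. a i t) has_real_derivative (\<Sum>i<n. - (a i t)\<^sup>2)) (at t)"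
      by (intro DERIV_sum der_a that)
    from DERIV_chain2[OF DERIV_ln[OF sum_a[OF that]] this]
    have "((\<lambda>t. ln (\<Sum>i<n. a i t)) has_real_derivative
        inverse (\<Sum>i<n. a i t) * (\<Sum>i<n. - (a i t)\<^sup>2)) (at t)" .
    moreover have "((\<lambda>t. \<Sum>i<n. ln (h i t)) has_real_derivative (\<Sum>i<n. a i t)) (at t)"
      by (intro DERIV_sum der_h that)
    ultimately have "(L has_real_derivative
        (\<Sum>i<n. a i t) + inverse (\<Sum>i<n. a i t) * (\<Sum>i<n. - (a i t)\<^sup>2)) (at t)"
      unfolding L_def by (rule DERIV_add[rotated])
    then show ?thesis by (simp add: L'_def sum_negf divide_inverse mult.commute)
  qed
  obtain t where t: "0 < t" "t < 1" and mvt: "L 1 - L 0 = (1 - 0) * L' t"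
    using MVT2[of 0 1 L L'] der by auto
  have "l - S / l \<le> L' t"
    unfolding l_def S_def L'_def using p a_ge t pos
    by (intro sum_minus_normalized_squares_mono) auto
  moreover have "L 1 = ln l" by (simp add: L_def h_def a_def l_def)
  moreover have "L 0 = ln (poibin p n 1)"
  proof -
    have "0 < (\<Prod>i<n. 1 - p i)" using p by (intro prod_pos) simp
    moreover have "(\<Sum>i<n. ln (1 - p i)) = ln (\<Prod>i<n. 1 - p i)"
      using p by (subst ln_prod) (auto simp: less_imp_neq)
    ultimately show ?thesis using sum_a[of 0]
      unfolding poibin_1[where p = p, OF p] by (simp add: L_def h_def a_def ln_mult_pos)
  qed
  ultimately have "ln (poibin p n 1) \<le> ln l + (S / l - l)" using mvt by simp
  also have "\<dots> = ln (l * exp (S / l - l))" using pos by (simp add: l_def ln_mult)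
  finally show ?thesis
    using poibin_1_pos[where p = p, OF p pos] pos by (simp add: l_def S_def)
qed

section \<open>Lower bound for the mass at one\<close>

text \<open>
  In the series of \<open>- ln (1 - x)\<close>, the terms \<open>x\<^sup>k / k\<close> with \<open>k \<ge> 2\<close> are at most \<open>x\<^sup>k / 2\<close> and
  thus sum up to at most \<open>x\<^sup>2 / (2 * (1 - x))\<close>. The proof compares derivatives instead: the gap
  between the two sides has derivative \<open>x\<^sup>2 / (2 * (1 - x)\<^sup>2)\<close>.
\<close>

lemma exp_le_one_minus:
  fixes x :: real
  assumes "0 \<le> x" "x < 1"
  shows "exp (- x - x\<^sup>2 / (2 * (1 - x))) \<le> 1 - x"
proof -
  define g where "g y = ln (1 - y) + y + y\<^sup>2 / (2 * (1 - y))" for y :: real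
  have "\<exists>d. (g has_real_derivative d) (at y) \<and> 0 \<le> d" if "0 \<le> y" "y \<le> x" for y
  proof (intro exI conjI)
    have y: "0 < 1 - y" using that assms by simp
    show "(g has_real_derivative
       (- 1 / (1 - y) + 1 + (2 * y * (2 * (1 - y)) - y\<^sup>2 * (- 2)) / (2 * (1 - y) * (2 * (1 - y))))) (at y)"
      unfolding g_def
      by (rule derivative_eq_intros refl | use y in \<open>simp\<close>)+
    have "- 1 / (1 - y) + 1 + (2 * y * (2 * (1 - y)) - y\<^sup>2 * (- 2)) / (2 * (1 - y) * (2 * (1 - y)))
        = y\<^sup>2 / (2 * (1 - y)\<^sup>2)"
      using y by (simp add: divide_simps power2_eq_square) (simp add: algebra_simps)
    then show "0 \<le> - 1 / (1 - y) + 1 + (2 * y * (2 * (1 - y)) - y\<^sup>2 * (- 2)) / (2 * (1 - y) * (2 * (1 - y)))"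
      by simp
  qed
  then have "g 0 \<le> g x" by (rule DERIV_nonneg_imp_nondecreasing[OF assms(1)])
  then have "- x - x\<^sup>2 / (2 * (1 - x)) \<le> ln (1 - x)" by (simp add: g_def)
  then have "exp (- x - x\<^sup>2 / (2 * (1 - x))) \<le> exp (ln (1 - x))" by simp
  then show ?thesis using assms by simp
qed

lemma poibin_1_ge:
  assumes p: "\<And>i. 0 \<le> p i \<and> p i < (1::real)" and m: "\<And>i. p i \<le> m" "m < 1"
  shows "exp (- (\<Sum>i<n. p i) - (\<Sum>i<n. (p i)\<^sup>2) / (2 * (1 - m))) * ((\<Sum>i<n. p i) + (\<Sum>i<n. (p i)\<^sup>2))
     \<le> poibin p n 1"
proof -
  have "exp (- (\<Sum>i<n. p i) - (\<Sum>i<n. (p i)\<^sup>2) / (2 * (1 - m)))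
      = (\<Prod>i<n. exp (- p i - (p i)\<^sup>2 / (2 * (1 - m))))"
    by (simp add: exp_sum[symmetric] sum_subtractf sum_negf sum_divide_distrib)
  also have "\<dots> \<le> (\<Prod>i<n. 1 - p i)"
  proof (intro prod_mono conjI)
    fix i
    have "(p i)\<^sup>2 / (2 * (1 - p i)) \<le> (p i)\<^sup>2 / (2 * (1 - m))"
      using m(1)[of i] m(2) by (intro divide_left_mono) auto
    then have "exp (- p i - (p i)\<^sup>2 / (2 * (1 - m))) \<le> exp (- p i - (p i)\<^sup>2 / (2 * (1 - p i)))"
      by simp
    also have "\<dots> \<le> 1 - p i" using p by (intro exp_le_one_minus) auto
    finally show "exp (- p i - (p i)\<^sup>2 / (2 * (1 - m))) \<le> 1 - p i" .
  qed simp
  finally show ?thesis unfolding poibin_1[where p = p, OF p]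
  proof (rule mult_mono)
    show "(\<Sum>i<n. p i) + (\<Sum>i<n. (p i)\<^sup>2) \<le> (\<Sum>i<n. p i / (1 - p i))"
      by (rule sum_le_sum_odds[where p = p, OF p])
    show "0 \<le> (\<Prod>i<n. 1 - p i)" using p by (intro prod_nonneg) (auto simp: less_imp_le)
    show "0 \<le> (\<Sum>i<n. p i) + (\<Sum>i<n. (p i)\<^sup>2)"
      using p by (intro add_nonneg_nonneg sum_nonneg) auto
  qed
qed

lemma ln_one_plus_ge:
  fixes x :: real
  assumes "0 \<le> x"
  shows "x - x\<^sup>2 / 2 \<le> ln (1 + x)"
proof -
  define g where "g y = ln (1 + y) - y + y\<^sup>2 / 2" for y :: real
  have "\<exists>d. (g has_real_derivative d) (at y) \<and> 0 \<le> d" if "0 \<le> y" "y \<le> x" for y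
  proof (intro exI conjI)
    show "(g has_real_derivative 1 / (1 + y) - 1 + y) (at y)"
      unfolding g_def by (rule derivative_eq_intros refl | use that in simp)+
    have "1 / (1 + y) - 1 + y = y\<^sup>2 / (1 + y)"
      using that by (simp add: field_simps power2_eq_square)
    then show "0 \<le> 1 / (1 + y) - 1 + y" using that by simp
  qed
  then have "g 0 \<le> g x" by (rule DERIV_nonneg_imp_nondecreasing[OF assms(1)])
  then show ?thesis by (simp add: g_def)
qed

section \<open>Passage to the infinite sum\<close>

lemma (in prob_space) indep_vars_random_variable:
  assumes "indep_vars M' X I" and "i \<in> I"
  shows "random_variable (M' i) (X i)"
  using assms(1)[unfolded indep_vars_def, THEN conjunct1] assms(2) by simp

lemma poibin_eq_prob_sum:
  fixes M :: "'a measure" and Z :: "nat \<Rightarrow> 'a \<Rightarrow> nat"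
  assumes "prob_space M"
    and indep: "prob_space.indep_vars M (\<lambda>_. count_space UNIV) Z UNIV"
    and p: "\<And>i. 0 \<le> p i \<and> p i \<le> 1"
    and bernoulli: "\<And>i. distr M (count_space UNIV) (Z i) =
                          measure_pmf (map_pmf of_bool (bernoulli_pmf (p i)))"
  shows "measure M {\<omega> \<in> space M. (\<Sum>i<n. Z i \<omega>) = x} = poibin p n x"
proof -
  interpret prob_space M by fact
  have Z[measurable]: "Z i \<in> measurable M (count_space UNIV)" for i
    by (rule indep_vars_random_variable[OF indep UNIV_I])
  have [measurable]: "(\<lambda>\<omega>. \<Sum>i<n. Z i \<omega>) \<in> measurable M (count_space UNIV)" for n
    by (induction n) simp_all
  have law: "prob {\<omega> \<in> space M. Z i \<omega> = k} = pmf (map_pmf of_bool (bernoulli_pmf (p i))) k" for i k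
  proof -
    have "prob {\<omega> \<in> space M. Z i \<omega> = k} = measure (distr M (count_space UNIV) (Z i)) {k}"
      by (subst measure_distr) (auto intro!: arg_cong[where f = prob])
    then show ?thesis unfolding bernoulli by (simp add: measure_pmf_single)
  qed
  have vim: "of_bool -` {0::nat} = {False}" "of_bool -` {1::nat} = {True}"
    by (auto simp: of_bool_def split: if_splits)
  have p0: "prob {\<omega> \<in> space M. Z i \<omega> = 0} = 1 - p i" for i
    unfolding law pmf_map vim using p[of i] by (simp add: measure_pmf_single)
  have p1: "prob {\<omega> \<in> space M. Z i \<omega> = 1} = p i" for i
    unfolding law pmf_map vim using p[of i] by (simp add: measure_pmf_single)
  have p2: "prob {\<omega> \<in> space M. Z i \<omega> \<ge> 2} = 0" for i
  proof -
    have "prob {\<omega> \<in> space M. Z i \<omega> \<ge> 2} = measure (distr M (count_space UNIV) (Z i)) {2..}"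
      by (subst measure_distr) (auto intro!: arg_cong[where f = prob])
    also have "\<dots> = measure_pmf.prob (bernoulli_pmf (p i)) (of_bool -` {2::nat..})"
      unfolding bernoulli by simp
    also have "of_bool -` {2::nat..} = {}" by (auto simp: of_bool_def split: if_splits)
    finally show ?thesis by simp
  qed
  have indep_real: "indep_vars (\<lambda>_. borel) (\<lambda>i \<omega>. real (Z i \<omega>)) UNIV"
    by (rule indep_vars_compose2[OF indep]) simp
  have joint: "prob {\<omega> \<in> space M. Z n \<omega> = k \<and> (\<Sum>i<n. Z i \<omega>) = x}
      = prob {\<omega> \<in> space M. Z n \<omega> = k} * prob {\<omega> \<in> space M. (\<Sum>i<n. Z i \<omega>) = x}" for n k x
  proof -
    have "indep_var borel (\<lambda>\<omega>. real (Z n \<omega>)) borel (\<lambda>\<omega>. \<Sum>i<n. real (Z i \<omega>))"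
      by (rule indep_vars_sum) (auto intro: indep_vars_subset[OF indep_real])
    from indep_varD[OF this, of "{real k}" "{real x}"]
    show ?thesis by (simp add: vimage_def Int_def conj_commute flip: of_nat_sum)
  qed
  show ?thesis
  proof (induction n arbitrary: x)
    case (Suc n)
    \<comment> \<open>Values of \<open>Z n\<close> other than \<open>0\<close> and \<open>1\<close> are possible on the null set \<open>B\<close>.\<close>
    define A where "A k = {\<omega> \<in> space M. Z n \<omega> = k \<and> (\<Sum>i<n. Z i \<omega>) = x - k}" for k
    define B where "B = {\<omega> \<in> space M. Z n \<omega> \<ge> 2 \<and> (\<Sum>i<Suc n. Z i \<omega>) = x}"
    have [measurable]: "A k \<in> events" "B \<in> events" for k unfolding A_def B_def by measurable
    have "prob B \<le> prob {\<omega> \<in> space M. Z n \<omega> \<ge> 2}" unfolding B_def by (intro finite_measure_mono) auto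
    then have B: "prob B = 0" using p2 measure_nonneg[of M B] by simp
    have A0: "prob (A 0) = (1 - p n) * poibin p n x"
      unfolding A_def joint Suc p0 by simp
    show ?case
    proof (cases x)
      case 0
      have "{\<omega> \<in> space M. (\<Sum>i<Suc n. Z i \<omega>) = x} = A 0" using 0 by (auto simp: A_def)
      then show ?thesis using A0 by (simp add: 0)
    next
      case x: (Suc y)
      have "{\<omega> \<in> space M. (\<Sum>i<Suc n. Z i \<omega>) = x} = (A 0 \<union> A 1) \<union> B"
        by (auto simp: A_def B_def x)
      also have "prob \<dots> = prob (A 0 \<union> A 1) + prob B"
        by (rule finite_measure_Union) (auto simp: A_def B_def)
      also have "prob (A 0 \<union> A 1) = prob (A 0) + prob (A 1)"
        by (rule finite_measure_Union) (auto simp: A_def)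
      also note A0
      also have "prob (A 1) = p n * poibin p n y"
        unfolding A_def joint Suc p1 by (simp add: x)
      finally show ?thesis by (simp add: B x)
    qed
  qed (simp add: prob_space of_bool_def)
qed

text \<open>
  Almost surely the partial sums are eventually equal to the infinite sum, so the indicators of the
  events converge almost surely, and dominated convergence applies.
\<close>

lemma poibin_tendsto_prob_suminf:
  fixes M :: "'a measure" and Z :: "nat \<Rightarrow> 'a \<Rightarrow> nat"
  assumes "prob_space M"
    and indep: "prob_space.indep_vars M (\<lambda>_. count_space UNIV) Z UNIV"
    and p: "\<And>i. 0 \<le> p i \<and> p i \<le> 1" and "summable p"
    and bernoulli: "\<And>i. distr M (count_space UNIV) (Z i) =
                          measure_pmf (map_pmf of_bool (bernoulli_pmf (p i)))"
  shows "(\<lambda>n. poibin p n x) \<longlonglongrightarrow> measure (sum_distribution M Z) {x}"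
proof -
  interpret prob_space M by fact
  have Z[measurable]: "Z i \<in> measurable M (count_space UNIV)" for i
    by (rule indep_vars_random_variable[OF indep UNIV_I])
  have [measurable]: "(\<lambda>\<omega>. \<Sum>i<n. Z i \<omega>) \<in> measurable M (count_space UNIV)" for n
    by (induction n) simp_all
  have [measurable]: "(\<lambda>\<omega>. \<Sum>i. Z i \<omega>) \<in> measurable M (count_space UNIV)"
    by (rule measurable_suminf_nat) simp
  have ae: "AE \<omega> in M. (\<lambda>n. indicator {\<omega> \<in> space M. (\<Sum>i<n. Z i \<omega>) = x} \<omega> :: real)
      \<longlonglongrightarrow> indicator {\<omega> \<in> space M. (\<Sum>i. Z i \<omega>) = x} \<omega>"
    using AE_summable_bernoulli[OF Z bernoulli p \<open>summable p\<close>]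
  proof eventually_elim
    case (elim \<omega>)
    then obtain N where "\<forall>n\<ge>N. (\<Sum>i<n. Z i \<omega>) = (\<Sum>i. Z i \<omega>)"
      using summable_sums sums_nat_iff by blast
    then show ?case
      by (intro tendsto_eventually) (auto simp: eventually_sequentially indicator_def intro!: exI[of _ N])
  qed
  have "(\<lambda>n. \<integral>\<omega>. indicator {\<omega> \<in> space M. (\<Sum>i<n. Z i \<omega>) = x} \<omega> \<partial>M)
      \<longlonglongrightarrow> (\<integral>\<omega>. indicator {\<omega> \<in> space M. (\<Sum>i. Z i \<omega>) = x} \<omega> \<partial>M :: real)"
    by (rule integral_dominated_convergence[where w = "\<lambda>_. 1"]) (use ae in \<open>auto simp: indicator_def\<close>)
  then have "(\<lambda>n. prob {\<omega> \<in> space M. (\<Sum>i<n. Z i \<omega>) = x}) \<longlonglongrightarrow>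
      prob {\<omega> \<in> space M. (\<Sum>i. Z i \<omega>) = x}"
    by (simp add: Int_def conj_commute)
  moreover have "measure (sum_distribution M Z) {x} = prob {\<omega> \<in> space M. (\<Sum>i. Z i \<omega>) = x}"
    unfolding sum_distribution_def
    by (subst measure_distr) (auto intro!: arg_cong[where f = prob])
  ultimately show ?thesis
    unfolding poibin_eq_prob_sum[OF assms(1,2) p bernoulli] by simp
qed

section \<open>Bounds for the maximal density ratio\<close>

theorem theorem2:
  fixes M :: "'a measure" and Z :: "nat \<Rightarrow> 'a \<Rightarrow> nat"
    and p :: "nat \<Rightarrow> real" and lam pmax \<Delta> :: real
  assumes p_range: "\<And>i. 0 \<le> p i \<and> p i < 1"
    and p_sums: "p sums lam"
    and lam_pos: "0 < lam" and lam_le_1: "lam \<le> 1"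
    and pmax: "pmax = (GREATEST y. y \<in> range p)"
    and Delta: "\<Delta> = (\<Sum>i. (p i)\<^sup>2) / lam"
    and prob: "prob_space M"
    and indep: "prob_space.indep_vars M (\<lambda>_. count_space UNIV) Z UNIV"
    and bernoulli: "\<And>i. distr M (count_space UNIV) (Z i) =
                          measure_pmf (map_pmf of_bool (bernoulli_pmf (p i)))"
  defines "\<rho> \<equiv> max_density_ratio (sum_distribution M Z) (measure_pmf (poisson_pmf lam))"
  shows "\<rho> < \<infinity> \<and>
         \<Delta> * (1 - \<Delta> / 2 - lam / (2 * (1 - pmax))) \<le> ln (enn2real \<rho>) \<and>
         ln (enn2real \<rho>) \<le> \<Delta>"
proof -
  interpret prob_space M by (fact prob)
  have Z: "Z i \<in> measurable M (count_space UNIV)" for i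
    by (rule indep_vars_random_variable[OF indep UNIV_I])
  have p_le: "0 \<le> p i \<and> p i \<le> 1" for i using p_range[of i] by simp
  have summ: "summable p" and lam: "(\<Sum>i. p i) = lam"
    using p_sums by (auto simp: sums_iff)
  interpret Q: prob_space "sum_distribution M Z"
    unfolding sum_distribution_def by (rule prob_space_distr) (rule measurable_suminf_nat[OF Z])
  define b where "b x = measure (sum_distribution M Z) {x}" for x
  define l where "l n = (\<Sum>i<n. p i)" for n
  define S where "S n = (\<Sum>i<n. (p i)\<^sup>2)" for n
  have lim_b: "(\<lambda>n. poibin p n x) \<longlonglongrightarrow> b x" for x
    unfolding b_def by (rule poibin_tendsto_prob_suminf) (use prob indep p_le summ bernoulli in auto)
  have lim_l: "l \<longlonglongrightarrow> lam" using p_sums unfolding sums_def l_def .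
  have sq: "summable (\<lambda>i. (p i)\<^sup>2)"
  proof (rule summable_comparison_test'[OF summ, of 0])
    show "norm ((p i)\<^sup>2) \<le> p i" for i
      using p_le[of i] mult_left_mono[of "p i" 1 "p i"] by (simp add: power2_eq_square)
  qed
  have lim_S: "S \<longlonglongrightarrow> lam * \<Delta>"
    using summable_LIMSEQ[OF sq] lam_pos unfolding S_def Delta by simp
  have l_le: "l n \<le> lam" for n
    unfolding l_def lam[symmetric] using p_le by (intro sum_le_suminf summ) auto
  have l_pos: "eventually (\<lambda>n. 0 < l n) sequentially"
    using order_tendstoD(1)[OF lim_l lam_pos] .
  have b_nonneg: "0 \<le> b x" for x by (simp add: b_def)

  have b0: "lam * b 0 \<le> b 1"
  proof (rule LIMSEQ_le)
    show "(\<lambda>n. l n * poibin p n 0) \<longlonglongrightarrow> lam * b 0" by (intro tendsto_mult lim_l lim_b)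
    show "(\<lambda>n. poibin p n 1) \<longlonglongrightarrow> b 1" by (rule lim_b)
  qed (use poibin_0_le[where p = p, OF p_range] in \<open>auto simp: l_def\<close>)
  have bS: "real (Suc x) * b (Suc x) \<le> lam * b x" if "1 \<le> x" for x
  proof (rule tendsto_le[OF sequentially_bot])
    show "(\<lambda>n. l n * poibin p n x) \<longlonglongrightarrow> lam * b x" by (intro tendsto_mult lim_l lim_b)
    show "(\<lambda>n. real (Suc x) * poibin p n (Suc x)) \<longlonglongrightarrow> real (Suc x) * b (Suc x)"
      by (intro tendsto_mult tendsto_const lim_b)
    show "eventually (\<lambda>n. real (Suc x) * poibin p n (Suc x) \<le> l n * poibin p n x) sequentially"
      using l_pos
    proof eventually_elim
      case (elim n)
      then show ?case
        using poibin_Suc_le[where p = p, OF p_range, where n = n and x = x] l_le[of n] lam_le_1 that by (simp add: l_def)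
    qed
  qed
  have upper: "b 1 \<le> lam * exp (\<Delta> - lam)"
  proof (rule tendsto_le[OF sequentially_bot])
    have "(\<lambda>n. l n * exp (S n / l n - l n)) \<longlonglongrightarrow> lam * exp (lam * \<Delta> / lam - lam)"
      using lam_pos by (intro tendsto_intros lim_l lim_S) auto
    then show "(\<lambda>n. l n * exp (S n / l n - l n)) \<longlonglongrightarrow> lam * exp (\<Delta> - lam)" using lam_pos by simp
    show "(\<lambda>n. poibin p n 1) \<longlonglongrightarrow> b 1" by (rule lim_b)
    show "eventually (\<lambda>n. poibin p n 1 \<le> l n * exp (S n / l n - l n)) sequentially"
      using l_pos by eventually_elim (use poibin_1_le[where p = p, OF p_range] in \<open>simp add: l_def S_def\<close>)
  qed
  have pm: "p i \<le> pmax" for i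
    unfolding pmax using p_range by (intro Greatest_range_summable(2) summ) auto
  have pm1: "pmax < 1"
    using Greatest_range_summable(1)[of p] p_range summ unfolding pmax[symmetric] by auto
  have lower: "exp (- lam - lam * \<Delta> / (2 * (1 - pmax))) * (lam + lam * \<Delta>) \<le> b 1"
  proof (rule LIMSEQ_le)
    show "(\<lambda>n. exp (- l n - S n / (2 * (1 - pmax))) * (l n + S n)) \<longlonglongrightarrow>
        exp (- lam - lam * \<Delta> / (2 * (1 - pmax))) * (lam + lam * \<Delta>)"
      using pm1 by (intro tendsto_intros lim_l lim_S) auto
    show "(\<lambda>n. poibin p n 1) \<longlonglongrightarrow> b 1" by (rule lim_b)
  qed (use poibin_1_ge[where p = p, OF p_range pm pm1] in \<open>auto simp: l_def S_def\<close>)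

  \<comment> \<open>The density ratio at \<open>x\<close>. By \<open>b0\<close> and \<open>bS\<close> it increases from \<open>0\<close> to \<open>1\<close> and decreases
    afterwards.\<close>
  define r where "r x = b x / (lam ^ x / fact x * exp (- lam))" for x
  have r_eq: "r x = exp lam * (fact x * b x / lam ^ x)" for x
    by (simp add: r_def exp_minus field_simps)
  have r_Suc: "r (Suc x) \<le> r x" if "1 \<le> x" for x
  proof -
    have "fact x * (real (Suc x) * b (Suc x)) \<le> fact x * (lam * b x)"
      using bS[OF that] by (intro mult_left_mono) auto
    then have "fact x * (real (Suc x) * b (Suc x)) / lam ^ Suc x \<le> fact x * (lam * b x) / lam ^ Suc x"
      using lam_pos by (intro divide_right_mono) auto
    also have "\<dots> = fact x * b x / lam ^ x" using lam_pos by simp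
    also have "fact x * (real (Suc x) * b (Suc x)) = fact (Suc x) * b (Suc x)"
      by (simp add: mult_ac)
    finally show ?thesis unfolding r_eq by (rule mult_left_mono) simp
  qed
  have r_le: "r x \<le> r 1" for x
  proof (cases x)
    case 0
    then show ?thesis using b0 lam_pos by (simp add: r_eq field_simps)
  next
    case (Suc y)
    have "r (Suc y) \<le> r 1"
    proof (induction y)
      case (Suc y)
      show ?case using r_Suc[of "Suc y"] Suc by simp
    qed simp
    then show ?thesis using Suc by simp
  qed
  have ratio: "emeasure (sum_distribution M Z) {x} / emeasure (measure_pmf (poisson_pmf lam)) {x}
      = ennreal (r x)" for x
  proof -
    have "emeasure (sum_distribution M Z) {x} = ennreal (b x)"
      by (simp add: b_def Q.emeasure_eq_measure)
    moreover have "emeasure (measure_pmf (poisson_pmf lam)) {x} = ennreal (lam ^ x / fact x * exp (- lam))"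
      using lam_pos by (simp add: emeasure_pmf_single)
    ultimately show ?thesis
      using lam_pos b_nonneg by (simp add: divide_ennreal r_def)
  qed
  have rho: "\<rho> = ennreal (r 1)"
    unfolding \<rho>_def max_density_ratio_def ratio
    by (intro antisym SUP_least SUP_upper ennreal_leI r_le) auto
  have D0: "0 \<le> \<Delta>"
    unfolding Delta using lam_pos sq by (intro divide_nonneg_pos suminf_nonneg) auto
  have r1: "r 1 = exp lam * (b 1 / lam)" by (simp add: r_eq)
  have lower_r: "exp (- lam * \<Delta> / (2 * (1 - pmax))) * (1 + \<Delta>) \<le> r 1"
  proof -
    have "exp (- lam * \<Delta> / (2 * (1 - pmax))) * (1 + \<Delta>) =
        exp lam * (exp (- lam - lam * \<Delta> / (2 * (1 - pmax))) * (lam + lam * \<Delta>) / lam)"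
      using lam_pos by (simp add: exp_diff exp_minus field_simps)
    also have "\<dots> \<le> r 1" unfolding r1
      using lower lam_pos by (intro mult_left_mono divide_right_mono) auto
    finally show ?thesis .
  qed
  have "0 < exp (- lam * \<Delta> / (2 * (1 - pmax))) * (1 + \<Delta>)" using D0 by simp
  then have r_pos: "0 < r 1" using lower_r by linarith
  have "r 1 \<le> exp lam * (lam * exp (\<Delta> - lam) / lam)"
    unfolding r1 using upper lam_pos by (intro mult_left_mono divide_right_mono) auto
  also have "\<dots> = exp \<Delta>" using lam_pos by (simp add: exp_diff)
  finally have "ln (r 1) \<le> \<Delta>" using r_pos by (metis ln_exp ln_le_cancel_iff exp_gt_zero)
  moreover have "\<Delta> * (1 - \<Delta> / 2 - lam / (2 * (1 - pmax))) \<le> ln (r 1)"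
  proof -
    have "\<Delta> - \<Delta>\<^sup>2 / 2 \<le> ln (1 + \<Delta>)"
      using D0 by (rule ln_one_plus_ge)
    then have "\<Delta> * (1 - \<Delta> / 2 - lam / (2 * (1 - pmax)))
        \<le> - lam * \<Delta> / (2 * (1 - pmax)) + ln (1 + \<Delta>)"
      by (simp add: power2_eq_square algebra_simps)
    also have "\<dots> = ln (exp (- lam * \<Delta> / (2 * (1 - pmax))) * (1 + \<Delta>))"
      using D0 by (simp add: ln_mult)
    also have "\<dots> \<le> ln (r 1)" using lower_r r_pos D0 by (subst ln_le_cancel_iff) auto
    finally show ?thesis .
  qed
  ultimately show ?thesis
    using r_pos by (simp add: rho less_imp_le)
qed

end
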